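(* For any closed term $f:(\mathbb{N}\to\mathbb{N})\to\mathbb{N}$ of Gödel's System $\mathrm{T}$, we have $f^\mathrm{b}(\Omega)(\alpha)=f(\alpha)$ for all $\alpha:\mathbb{N}\to\mathbb{N}$, where $\Omega:\mathbb{N}^\mathrm{b}\to\mathbb{N}^\mathrm{b}$ is defined by $\Omega(g)(\alpha):\equiv\alpha(g\alpha)$.
   Context: Gödel's System $\mathrm{T}$: finite types are generated from the base type $\mathbb{N}$ by function types $\sigma\to\tau$. Terms are those of the simply typed lambda calculus (variables, $\lambda$-abstraction, application) extended with constants $0:\mathbb{N}$, $\mathrm{succ}:\mathbb{N}\to\mathbb{N}$ and, for each finite type $\rho$, $\mathrm{rec}_\rho:\rho\to(\mathbb{N}\to\rho\to\rho)\to\mathbb{N}\to\rho$ with $\mathrm{rec}(a)(f)(0)=a$ and $\mathrm{rec}(a)(f)(\mathrm{succ}\,n)=f(n)(\mathrm{rec}(a)(f)(n))$. The $\mathrm{b}$-translation: types are translated by $\mathbb{N}^\mathrm{b}:\equiv(\mathbb{N}\to\mathbb{N})\to\mathbb{N}$ and $(\sigma\to\tau)^\mathrm{b}:\equiv\sigma^\mathrm{b}\to\tau^\mathrm{b}$. Each variable $x:\rho$ is assigned a variable $x^\mathrm{b}:\rho^\mathrm{b}$, and terms are translated by $(x)^\mathrm{b}:\equiv x^\mathrm{b}$, $(\lambda x.u)^\mathrm{b}:\equiv\lambda x^\mathrm{b}.u^\mathrm{b}$, $(fa)^\mathrm{b}:\equiv f^\mathrm{b}a^\mathrm{b}$, $0^\mathrm{b}:\equiv\lambda\alpha.0$,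 $\mathrm{succ}^\mathrm{b}:\equiv\lambda f\alpha.\mathrm{succ}(f\alpha)$, $\mathrm{rec}^\mathrm{b}:\equiv\lambda af.\mathrm{ke}(\mathrm{rec}(a)(\lambda k.f(\lambda\alpha.k)))$, where $\mathrm{ke}_\rho:(\mathbb{N}\to\rho^\mathrm{b})\to\mathbb{N}^\mathrm{b}\to\rho^\mathrm{b}$ is defined by $\mathrm{ke}_\mathbb{N}(g)(f):\equiv\lambda\alpha.g(f\alpha)(\alpha)$ and $\mathrm{ke}_{\sigma\to\tau}(g)(f):\equiv\lambda x.\mathrm{ke}_\tau(\lambda k.g(k)(x))(f)$. Thus for $f:(\mathbb{N}\to\mathbb{N})\to\mathbb{N}$, $f^\mathrm{b}:(\mathbb{N}^\mathrm{b}\to\mathbb{N}^\mathrm{b})\to\mathbb{N}^\mathrm{b}$. *)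

theory Defs
  imports Main
begin

datatype ty = N | Fun ty ty  (infixr "\<rightarrow>" 60)

(* Church-style terms with de Bruijn indices: Lam s u abstracts over a variable of type s. *)
datatype tm = Var nat | Lam ty tm | App tm tm | Zero | Succ | Rec ty

inductive has_type :: "ty list \<Rightarrow> tm \<Rightarrow> ty \<Rightarrow> bool"  ("_ \<turnstile> _ : _" [50, 50, 50] 50) where
  Var: "i < length \<Gamma> \<Longrightarrow> \<Gamma> \<turnstile> Var i : \<Gamma> ! i"
| Lam: "\<sigma> # \<Gamma> \<turnstile> u : \<tau> \<Longrightarrow> \<Gamma> \<turnstile> Lam \<sigma> u : \<sigma> \<rightarrow> \<tau>"
| App: "\<Gamma> \<turnstile> s : \<sigma> \<rightarrow> \<tau> \<Longrightarrow> \<Gamma> \<turnstile> t : \<sigma> \<Longrightarrow> \<Gamma> \<turnstile> App s t : \<tau>"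
| Zero: "\<Gamma> \<turnstile> Zero : N"
| Succ: "\<Gamma> \<turnstile> Succ : N \<rightarrow> N"
| Rec: "\<Gamma> \<turnstile> Rec \<rho> : \<rho> \<rightarrow> (N \<rightarrow> \<rho> \<rightarrow> \<rho>) \<rightarrow> N \<rightarrow> \<rho>"

fun bty :: "ty \<Rightarrow> ty" where
  "bty N = (N \<rightarrow> N) \<rightarrow> N"
| "bty (\<sigma> \<rightarrow> \<tau>) = bty \<sigma> \<rightarrow> bty \<tau>"

(* ke N = \<lambda>g f \<alpha>. g (f \<alpha>) \<alpha>   and   ke (\<sigma> \<rightarrow> \<tau>) = \<lambda>g f x. ke \<tau> (\<lambda>k. g k x) f *)
fun ke :: "ty \<Rightarrow> tm" where
  "ke N = Lam (N \<rightarrow> bty N) (Lam (bty N) (Lam (N \<rightarrow> N)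
     (App (App (Var 2) (App (Var 1) (Var 0))) (Var 0))))"
| "ke (\<sigma> \<rightarrow> \<tau>) = Lam (N \<rightarrow> bty (\<sigma> \<rightarrow> \<tau>)) (Lam (bty N) (Lam (bty \<sigma>)
     (App (App (ke \<tau>) (Lam N (App (App (Var 3) (Var 0)) (Var 1)))) (Var 1))))"

(* The variable assigned to Var i is Var i itself, now of type bty (\<Gamma> ! i).
   Rec \<rho> is sent to \<lambda>a f. ke \<rho> (rec a (\<lambda>k. f (\<lambda>\<alpha>. k))), with the recursor at type bty \<rho>. *)
fun btr :: "tm \<Rightarrow> tm" where
  "btr (Var i) = Var i"
| "btr (Lam \<sigma> u) = Lam (bty \<sigma>) (btr u)"
| "btr (App s t) = App (btr s) (btr t)"
| "btr Zero = Lam (N \<rightarrow> N) Zero"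
| "btr Succ = Lam (bty N) (Lam (N \<rightarrow> N) (App Succ (App (Var 1) (Var 0))))"
| "btr (Rec \<rho>) = Lam (bty \<rho>) (Lam (bty (N \<rightarrow> \<rho> \<rightarrow> \<rho>))
     (App (ke \<rho>) (App (App (Rec (bty \<rho>)) (Var 1))
       (Lam N (App (Var 1) (Lam (N \<rightarrow> N) (Var 1)))))))"

(* \<lambda>g \<alpha>. \<alpha> (g \<alpha>) *)
definition Omega :: tm where
  "Omega = Lam (bty N) (Lam (N \<rightarrow> N) (App (Var 0) (App (Var 1) (Var 0))))"

lemma ke_type: "\<Gamma> \<turnstile> ke \<rho> : (N \<rightarrow> bty \<rho>) \<rightarrow> bty N \<rightarrow> bty \<rho>"
proof (induction \<rho> arbitrary: \<Gamma>)
  case N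
  have "(N \<rightarrow> N) # bty N # (N \<rightarrow> bty N) # \<Gamma> \<turnstile> Var i : ((N \<rightarrow> N) # bty N # (N \<rightarrow> bty N) # \<Gamma>) ! i"
    if "i < 3" for i using that by (intro has_type.Var) simp
  from this[of 0] this[of 1] this[of 2] show ?case
    by (auto intro!: has_type.Lam intro: has_type.App)
next
  case (Fun \<sigma> \<tau>)
  let ?\<Delta> = "bty \<sigma> # bty N # (N \<rightarrow> bty (\<sigma> \<rightarrow> \<tau>)) # \<Gamma>"
  have 1: "N # ?\<Delta> \<turnstile> Var i : (N # ?\<Delta>) ! i" if "i < 4" for i
    using that by (intro has_type.Var) simp
  have "N # ?\<Delta> \<turnstile> App (App (Var 3) (Var 0)) (Var 1) : bty \<tau>"
    using 1[of 0] 1[of 1] 1[of 3] by (auto intro: has_type.App)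
  moreover have "?\<Delta> \<turnstile> Var 1 : bty N" using has_type.Var[of 1 ?\<Delta>] by simp
  ultimately show ?case
    using Fun.IH(2)[of ?\<Delta>] by (auto intro!: has_type.Lam intro: has_type.App has_type.Lam)
qed

lemma btr_type: "\<Gamma> \<turnstile> t : \<tau> \<Longrightarrow> map bty \<Gamma> \<turnstile> btr t : bty \<tau>"
proof (induction rule: has_type.induct)
  case (Var i \<Gamma>)
  then show ?case using has_type.Var[of i "map bty \<Gamma>"] by simp
next
  case (Succ \<Gamma>)
  let ?\<Delta> = "(N \<rightarrow> N) # bty N # map bty \<Gamma>"
  show ?case using has_type.Var[of 0 ?\<Delta>] has_type.Var[of 1 ?\<Delta>]
    by (auto intro!: has_type.Lam intro: has_type.App has_type.Succ)
next
  case (Rec \<Gamma> \<rho>)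
  let ?\<Delta> = "bty (N \<rightarrow> \<rho> \<rightarrow> \<rho>) # bty \<rho> # map bty \<Gamma>"
  have "(N \<rightarrow> N) # N # ?\<Delta> \<turnstile> Var 1 : N" using has_type.Var[of 1 "(N \<rightarrow> N) # N # ?\<Delta>"] by simp
  moreover have "N # ?\<Delta> \<turnstile> Var 1 : bty (N \<rightarrow> \<rho> \<rightarrow> \<rho>)" using has_type.Var[of 1 "N # ?\<Delta>"] by simp
  ultimately have "?\<Delta> \<turnstile> Lam N (App (Var 1) (Lam (N \<rightarrow> N) (Var 1))) : N \<rightarrow> bty \<rho> \<rightarrow> bty \<rho>"
    by (auto intro: has_type.Lam has_type.App)
  moreover have "?\<Delta> \<turnstile> Var 1 : bty \<rho>" using has_type.Var[of 1 ?\<Delta>] by simp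
  ultimately have "?\<Delta> \<turnstile> App (App (Rec (bty \<rho>)) (Var 1))
      (Lam N (App (Var 1) (Lam (N \<rightarrow> N) (Var 1)))) : N \<rightarrow> bty \<rho>"
    using has_type.Rec has_type.App by blast
  from has_type.App[OF ke_type this] show ?case
    by (auto intro!: has_type.Lam)
qed (auto intro: has_type.intros)

lemma Omega_type: "\<Gamma> \<turnstile> Omega : bty N \<rightarrow> bty N"
proof -
  let ?\<Delta> = "(N \<rightarrow> N) # bty N # \<Gamma>"
  show ?thesis using has_type.Var[of 0 ?\<Delta>] has_type.Var[of 1 ?\<Delta>]
    by (auto simp: Omega_def intro!: has_type.Lam intro: has_type.App)
qed

(* Models of System T over the standard natural numbers. No extensionality is required.
   In HOL no single type contains the full set-theoretic hierarchy over the naturals, so the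
   interpretation of the finite types is left abstract: D \<sigma> is the set of objects of type \<sigma>,
   app is application, num n is the object n, and sem e t is the value of t when Var i has
   the value e ! i. An untyped app is no restriction, as objects may be tagged with their types. *)
locale T_model =
  fixes D :: "ty \<Rightarrow> 'u set"
    and app :: "'u \<Rightarrow> 'u \<Rightarrow> 'u"
    and num :: "nat \<Rightarrow> 'u"
    and sem :: "'u list \<Rightarrow> tm \<Rightarrow> 'u"
  assumes num_inj: "inj num"
    and D_N: "D N = range num"
    and app_in: "g \<in> D (\<sigma> \<rightarrow> \<tau>) \<Longrightarrow> d \<in> D \<sigma> \<Longrightarrow> app g d \<in> D \<tau>"
    and sem_in: "\<Gamma> \<turnstile> t : \<tau> \<Longrightarrow> list_all2 (\<lambda>d \<sigma>. d \<in> D \<sigma>) e \<Gamma> \<Longrightarrow> sem e t \<in> D \<tau>"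
    and sem_Var: "\<Gamma> \<turnstile> Var i : \<tau> \<Longrightarrow> list_all2 (\<lambda>d \<sigma>. d \<in> D \<sigma>) e \<Gamma> \<Longrightarrow> sem e (Var i) = e ! i"
    and sem_Lam: "\<Gamma> \<turnstile> Lam \<sigma> u : \<sigma> \<rightarrow> \<tau> \<Longrightarrow> list_all2 (\<lambda>d \<sigma>. d \<in> D \<sigma>) e \<Gamma> \<Longrightarrow> d \<in> D \<sigma>
      \<Longrightarrow> app (sem e (Lam \<sigma> u)) d = sem (d # e) u"
    and sem_App: "\<Gamma> \<turnstile> App s t : \<tau> \<Longrightarrow> list_all2 (\<lambda>d \<sigma>. d \<in> D \<sigma>) e \<Gamma>
      \<Longrightarrow> sem e (App s t) = app (sem e s) (sem e t)"
    and sem_Zero: "list_all2 (\<lambda>d \<sigma>. d \<in> D \<sigma>) e \<Gamma> \<Longrightarrow> sem e Zero = num 0"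
    and sem_Succ: "list_all2 (\<lambda>d \<sigma>. d \<in> D \<sigma>) e \<Gamma>
      \<Longrightarrow> app (sem e Succ) (num n) = num (Suc n)"
    and sem_Rec_0: "list_all2 (\<lambda>d \<sigma>. d \<in> D \<sigma>) e \<Gamma> \<Longrightarrow> a \<in> D \<rho> \<Longrightarrow> g \<in> D (N \<rightarrow> \<rho> \<rightarrow> \<rho>)
      \<Longrightarrow> app (app (app (sem e (Rec \<rho>)) a) g) (num 0) = a"
    and sem_Rec_Suc: "list_all2 (\<lambda>d \<sigma>. d \<in> D \<sigma>) e \<Gamma> \<Longrightarrow> a \<in> D \<rho> \<Longrightarrow> g \<in> D (N \<rightarrow> \<rho> \<rightarrow> \<rho>)
      \<Longrightarrow> app (app (app (sem e (Rec \<rho>)) a) g) (num (Suc n)) =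
          app (app g (num n)) (app (app (app (sem e (Rec \<rho>)) a) g) (num n))"

text \<open>A model whose objects of type \<open>N \<rightarrow> N\<close> include all functions on the naturals, obtained
  by call-by-value evaluation with oracles.\<close>

datatype val = VNum nat | VClo tm "val list" | VSucc | VRec | VRec1 val | VRec2 val val
  | VOracle "nat \<Rightarrow> nat"

inductive eval :: "val list \<Rightarrow> tm \<Rightarrow> val \<Rightarrow> bool" and ap :: "val \<Rightarrow> val \<Rightarrow> val \<Rightarrow> bool" where
  "eval e (Var i) (e ! i)"
| "eval e (Lam \<sigma> u) (VClo u e)"
| "eval e s v \<Longrightarrow> eval e t w \<Longrightarrow> ap v w x \<Longrightarrow> eval e (App s t) x"
| "eval e Zero (VNum 0)"
| "eval e Succ VSucc"
| "eval e (Rec \<rho>) VRec"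
| "eval (w # e) u x \<Longrightarrow> ap (VClo u e) w x"
| "ap VSucc (VNum n) (VNum (Suc n))"
| "ap VRec a (VRec1 a)"
| "ap (VRec1 a) g (VRec2 a g)"
| "ap (VRec2 a g) (VNum 0) a"
| "ap (VRec2 a g) (VNum n) r \<Longrightarrow> ap g (VNum n) h \<Longrightarrow> ap h r x \<Longrightarrow> ap (VRec2 a g) (VNum (Suc n)) x"
| "ap (VOracle \<alpha>) (VNum n) (VNum (\<alpha> n))"

inductive_cases eval_cases: "eval e (Var i) x" "eval e (Lam \<sigma> u) x" "eval e (App s t) x"
  "eval e Zero x" "eval e Succ x" "eval e (Rec \<rho>) x"
inductive_cases ap_cases: "ap (VClo u e) w x" "ap VSucc w x" "ap VRec w x" "ap (VRec1 a) w x"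
  "ap (VRec2 a g) (VNum 0) x" "ap (VRec2 a g) (VNum (Suc n)) x" "ap (VOracle \<alpha>) w x"

lemma eval_ap_det:
  "eval e t x \<Longrightarrow> eval e t y \<Longrightarrow> x = y"
  "ap v w x \<Longrightarrow> ap v w y \<Longrightarrow> x = y"
proof -
  have "(eval e t x \<longrightarrow> (\<forall>y. eval e t y \<longrightarrow> x = y)) \<and> (ap v w x \<longrightarrow> (\<forall>y. ap v w y \<longrightarrow> x = y))"
    for e t v w x
    by (rule eval_ap.induct) (blast elim: eval_cases ap_cases)+
  then show "eval e t x \<Longrightarrow> eval e t y \<Longrightarrow> x = y" "ap v w x \<Longrightarrow> ap v w y \<Longrightarrow> x = y"
    by blast+
qed

fun VD :: "ty \<Rightarrow> val set" where
  "VD N = range VNum"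
| "VD (\<sigma> \<rightarrow> \<tau>) = {v. \<forall>w \<in> VD \<sigma>. \<exists>x \<in> VD \<tau>. ap v w x}"

definition vapp :: "val \<Rightarrow> val \<Rightarrow> val" where "vapp v w = (THE x. ap v w x)"
definition vsem :: "val list \<Rightarrow> tm \<Rightarrow> val" where "vsem e t = (THE x. eval e t x)"

lemma vapp_eq: "ap v w x \<Longrightarrow> vapp v w = x"
  unfolding vapp_def by (blast intro: eval_ap_det)

lemma vsem_eq: "eval e t x \<Longrightarrow> vsem e t = x"
  unfolding vsem_def by (blast intro: eval_ap_det)

lemma VRec2_total:
  assumes "a \<in> VD \<rho>" and "g \<in> VD (N \<rightarrow> \<rho> \<rightarrow> \<rho>)"
  shows "\<exists>x \<in> VD \<rho>. ap (VRec2 a g) (VNum n) x"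
proof (induction n)
  case 0
  then show ?case using assms(1) eval_ap.intros(11) by blast
next
  case (Suc n)
  then obtain r where r: "r \<in> VD \<rho>" "ap (VRec2 a g) (VNum n) r" by blast
  obtain h where h: "h \<in> VD (\<rho> \<rightarrow> \<rho>)" "ap g (VNum n) h"
    using assms(2) by (auto simp del: VD.simps(2) simp: VD.simps(2)[of N])
  obtain x where "x \<in> VD \<rho>" "ap h r x" using h(1) r(1) by auto
  then show ?case using r h eval_ap.intros(12) by blast
qed

lemma eval_total:
  "\<Gamma> \<turnstile> t : \<tau> \<Longrightarrow> list_all2 (\<lambda>d \<sigma>. d \<in> VD \<sigma>) e \<Gamma> \<Longrightarrow> \<exists>x \<in> VD \<tau>. eval e t x"
proof (induction arbitrary: e rule: has_type.induct)
  case (Var i \<Gamma>)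
  then show ?case using eval_ap.intros(1) list_all2_nthD2 by fastforce
next
  case (Lam \<sigma> \<Gamma> u \<tau>)
  have "VClo u e \<in> VD (\<sigma> \<rightarrow> \<tau>)"
    using Lam.IH[of "_ # e"] Lam.prems by simp (meson eval_ap.intros(7))
  then show ?case using eval_ap.intros(2) by blast
next
  case (App \<Gamma> s \<sigma> \<tau> t)
  obtain v where "v \<in> VD (\<sigma> \<rightarrow> \<tau>)" "eval e s v" using App by blast
  moreover obtain w where "w \<in> VD \<sigma>" "eval e t w" using App by blast
  ultimately show ?case using eval_ap.intros(3) by fastforce
next
  case (Zero \<Gamma>)
  then show ?case using eval_ap.intros(4) by auto
next
  case (Succ \<Gamma>)
  have "VSucc \<in> VD (N \<rightarrow> N)" using eval_ap.intros(8) by auto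
  then show ?case using eval_ap.intros(5) by blast
next
  case (Rec \<Gamma> \<rho>)
  have "VRec2 a g \<in> VD (N \<rightarrow> \<rho>)" if "a \<in> VD \<rho>" "g \<in> VD (N \<rightarrow> \<rho> \<rightarrow> \<rho>)" for a g
    using VRec2_total[OF that] by auto
  then have "VRec1 a \<in> VD ((N \<rightarrow> \<rho> \<rightarrow> \<rho>) \<rightarrow> N \<rightarrow> \<rho>)" if "a \<in> VD \<rho>" for a
    using that eval_ap.intros(10) unfolding VD.simps(2)[of "N \<rightarrow> \<rho> \<rightarrow> \<rho>"] by blast
  then have "VRec \<in> VD (\<rho> \<rightarrow> (N \<rightarrow> \<rho> \<rightarrow> \<rho>) \<rightarrow> N \<rightarrow> \<rho>)"
    using eval_ap.intros(9) unfolding VD.simps(2)[of \<rho> "_ \<rightarrow> _ \<rightarrow> _"] by blast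
  then show ?case using eval_ap.intros(6) by blast
qed

lemma T_model_val: "T_model VD vapp VNum vsem"
proof
  show "inj VNum" by (simp add: inj_def)
  show "VD N = range VNum" by simp
  show "vapp g d \<in> VD \<tau>" if "g \<in> VD (\<sigma> \<rightarrow> \<tau>)" "d \<in> VD \<sigma>" for g d \<sigma> \<tau>
    using that vapp_eq by fastforce
  show "vsem e t \<in> VD \<tau>" if "\<Gamma> \<turnstile> t : \<tau>" "list_all2 (\<lambda>d \<sigma>. d \<in> VD \<sigma>) e \<Gamma>" for \<Gamma> t \<tau> e
    using eval_total[OF that] vsem_eq by blast
  show "vsem e (Var i) = e ! i" for e i
    by (rule vsem_eq) (rule eval_ap.intros)
  show "vapp (vsem e (Lam \<sigma> u)) d = vsem (d # e) u"
    if lam: "\<Gamma> \<turnstile> Lam \<sigma> u : \<sigma> \<rightarrow> \<tau>" "list_all2 (\<lambda>d \<sigma>. d \<in> VD \<sigma>) e \<Gamma>" "d \<in> VD \<sigma>" for \<Gamma> \<sigma> u \<tau> e d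
  proof -
    have "\<sigma> # \<Gamma> \<turnstile> u : \<tau>" using lam(1) by (cases rule: has_type.cases) auto
    then obtain x where "eval (d # e) u x"
      using eval_total[of "\<sigma> # \<Gamma>" u \<tau> "d # e"] lam(2,3) by auto
    then show ?thesis using vapp_eq vsem_eq eval_ap.intros(2,7) by metis
  qed
  show "vsem e (App s t) = vapp (vsem e s) (vsem e t)"
    if "\<Gamma> \<turnstile> App s t : \<tau>" "list_all2 (\<lambda>d \<sigma>. d \<in> VD \<sigma>) e \<Gamma>" for \<Gamma> s t \<tau> e
    using eval_total[OF that] by (auto elim!: eval_cases simp: vapp_eq vsem_eq
        intro!: vsem_eq eval_ap.intros(3))
  show "vsem e Zero = VNum 0" for e by (rule vsem_eq) (rule eval_ap.intros)
  show "vapp (vsem e Succ) (VNum n) = VNum (Suc n)" for e n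
    using vsem_eq[OF eval_ap.intros(5)] vapp_eq[OF eval_ap.intros(8)] by simp
  have rec: "vapp (vapp (vsem e (Rec \<rho>)) a) g = VRec2 a g" for e \<rho> a g
    using vsem_eq[OF eval_ap.intros(6)] vapp_eq[OF eval_ap.intros(9)] vapp_eq[OF eval_ap.intros(10)]
    by simp
  show "vapp (vapp (vapp (vsem e (Rec \<rho>)) a) g) (VNum 0) = a" for e \<rho> a g
    using vapp_eq[OF eval_ap.intros(11)] by (simp add: rec)
  show "vapp (vapp (vapp (vsem e (Rec \<rho>)) a) g) (VNum (Suc n)) =
      vapp (vapp g (VNum n)) (vapp (vapp (vapp (vsem e (Rec \<rho>)) a) g) (VNum n))"
    if ag: "a \<in> VD \<rho>" "g \<in> VD (N \<rightarrow> \<rho> \<rightarrow> \<rho>)" for e \<rho> a g n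
  proof -
    obtain x where "ap (VRec2 a g) (VNum (Suc n)) x" using VRec2_total[OF ag] by blast
    then show ?thesis by (auto elim!: ap_cases simp: rec vapp_eq
        intro!: vapp_eq eval_ap.intros(12))
  qed
qed

lemma T_model_val_oracle:
  "VOracle \<alpha> \<in> VD (N \<rightarrow> N)" "vapp (VOracle \<alpha>) (VNum n) = VNum (\<alpha> n)"
  using eval_ap.intros(13) vapp_eq by auto

end

theory Submission
  imports Defs
begin

text \<open>Fix \<open>\<alpha>\<close> and relate objects of type \<open>bty \<rho>\<close> to objects of type \<open>\<rho>\<close> by the logical
  relation that, at type \<open>N\<close>, relates \<open>g\<close> to \<open>n\<close> iff \<open>g \<alpha> = n\<close>. Every term is related to its
  translation. For the recursor one uses that \<open>ke g f\<close> is related to whatever \<open>g (f \<alpha>)\<close> is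
  related to. Since \<open>Omega\<close> is related to \<open>\<alpha>\<close>, the object \<open>btr f Omega\<close> is related to
  \<open>f \<alpha>\<close>, which is the claim.\<close>

text \<open>The equations for \<open>sem\<close> come with typing premises. A computable type
  checker turns these premises into equations that rewriting can settle.\<close>

fun infer :: "ty list \<Rightarrow> tm \<Rightarrow> ty option" where
  "infer \<Gamma> (Var i) = (if i < length \<Gamma> then Some (\<Gamma> ! i) else None)"
| "infer \<Gamma> (Lam \<sigma> u) = map_option (Fun \<sigma>) (infer (\<sigma> # \<Gamma>) u)"
| "infer \<Gamma> (App s t) = (case (infer \<Gamma> s, infer \<Gamma> t) of
     (Some (\<sigma> \<rightarrow> \<tau>), Some \<sigma>') \<Rightarrow> if \<sigma> = \<sigma>' then Some \<tau> else None | _ \<Rightarrow> None)"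
| "infer \<Gamma> Zero = Some N"
| "infer \<Gamma> Succ = Some (N \<rightarrow> N)"
| "infer \<Gamma> (Rec \<rho>) = Some (\<rho> \<rightarrow> (N \<rightarrow> \<rho> \<rightarrow> \<rho>) \<rightarrow> N \<rightarrow> \<rho>)"

lemma infer_complete: "\<Gamma> \<turnstile> t : \<tau> \<Longrightarrow> infer \<Gamma> t = Some \<tau>"
  by (induction rule: has_type.induct) auto

lemma infer_sound: "infer \<Gamma> t = Some \<tau> \<Longrightarrow> \<Gamma> \<turnstile> t : \<tau>"
  by (induction \<Gamma> t arbitrary: \<tau> rule: infer.induct)
    (auto intro: has_type.intros split: if_splits option.splits ty.splits)

text \<open>For a variable \<open>\<rho>\<close> the term \<open>ke \<rho>\<close> does not unfold,
  so \<open>infer\<close> must treat it like a constant of known type.\<close>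

lemma infer_ke [simp]: "infer \<Gamma> (ke \<rho>) = Some ((N \<rightarrow> bty \<rho>) \<rightarrow> bty N \<rightarrow> bty \<rho>)"
  by (rule infer_complete[OF ke_type])

context T_model
begin

abbreviation env :: "'u list \<Rightarrow> ty list \<Rightarrow> bool" where
  "env \<equiv> list_all2 (\<lambda>d \<sigma>. d \<in> D \<sigma>)"

text \<open>This and the next three facts restate the model laws with \<open>env\<close> first:
  instantiating it fixes the context and leaves the remaining conditions to
  \<open>simp\<close>.\<close>

lemma sem_in_infer: "env e \<Gamma> \<Longrightarrow> infer \<Gamma> t = Some \<tau> \<Longrightarrow> sem e t \<in> D \<tau>"
  using sem_in infer_sound by blast

lemma sem_Var_env: "env e \<Gamma> \<Longrightarrow> i < length \<Gamma> \<Longrightarrow> sem e (Var i) = e ! i"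
  using sem_Var has_type.Var by blast

lemma app_sem_Lam:
  "env e \<Gamma> \<Longrightarrow> infer (\<sigma> # \<Gamma>) u = Some \<tau> \<Longrightarrow> d \<in> D \<sigma> \<Longrightarrow> app (sem e (Lam \<sigma> u)) d = sem (d # e) u"
  using sem_Lam has_type.Lam infer_sound by blast

lemma sem_App_infer:
  "env e \<Gamma> \<Longrightarrow> infer \<Gamma> (App s t) = Some \<tau> \<Longrightarrow> sem e (App s t) = app (sem e s) (sem e t)"
  using sem_App infer_sound by blast

text \<open>The quantifiers range over \<open>D\<close> only, since the beta law
  \<open>sem_Lam\<close> covers no other arguments.\<close>

fun rel :: "'u \<Rightarrow> ty \<Rightarrow> 'u \<Rightarrow> 'u \<Rightarrow> bool" where
  "rel \<alpha> N g n \<longleftrightarrow> app g \<alpha> = n"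
| "rel \<alpha> (\<sigma> \<rightarrow> \<tau>) g h \<longleftrightarrow>
     (\<forall>x \<in> D (bty \<sigma>). \<forall>y \<in> D \<sigma>. rel \<alpha> \<sigma> x y \<longrightarrow> rel \<alpha> \<tau> (app g x) (app h y))"

text \<open>At \<open>N\<close> this is the equation
  \<open>ke g f \<alpha> = g (f \<alpha>) \<alpha>\<close>. At a function type \<open>ke\<close>
  pushes the argument \<open>x\<close> inside, and the new family \<open>k \<mapsto> g k x\<close>
  takes at \<open>f \<alpha>\<close> the value \<open>g (f \<alpha>) x\<close>, so the hypothesis
  passes down to the result type.\<close>

lemma rel_ke:
  assumes "\<alpha> \<in> D (N \<rightarrow> N)" "env e \<Gamma>" "g \<in> D (N \<rightarrow> bty \<rho>)" "f \<in> D (bty N)"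
    and "rel \<alpha> \<rho> (app g (app f \<alpha>)) y"
  shows "rel \<alpha> \<rho> (app (app (sem e (ke \<rho>)) g) f) y"
  using assms(2-)
\<comment> \<open>The environment varies because the inner \<open>ke \<tau>\<close> is evaluated
  under three binders.\<close>
proof (induction \<rho> arbitrary: e \<Gamma> g f y)
  case N
  let ?\<Gamma>1 = "(N \<rightarrow> bty N) # \<Gamma>"
  let ?\<Gamma>2 = "bty N # ?\<Gamma>1"
  let ?\<Gamma>3 = "(N \<rightarrow> N) # ?\<Gamma>2"
  have e: "env (g # e) ?\<Gamma>1" "env (f # g # e) ?\<Gamma>2" "env (\<alpha> # f # g # e) ?\<Gamma>3"
    using N assms(1) by auto
  show ?case
    using N assms(1)
    by (simp add: app_sem_Lam[OF N(1)] e[THEN app_sem_Lam] e[THEN sem_App_infer]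
        e[THEN sem_Var_env])
next
  case (Fun \<sigma> \<tau>)
  let ?\<Gamma>1 = "(N \<rightarrow> bty (\<sigma> \<rightarrow> \<tau>)) # \<Gamma>"
  let ?\<Gamma>2 = "bty N # ?\<Gamma>1"
  let ?\<Gamma>3 = "bty \<sigma> # ?\<Gamma>2"
  \<comment> \<open>The family \<open>k \<mapsto> g k x\<close>: under its binder, indices 0, 1 and
    3 stand for \<open>k\<close>, \<open>x\<close> and \<open>g\<close>.\<close>
  let ?L = "Lam N (App (App (Var 3) (Var 0)) (Var 1))"
  have "rel \<alpha> \<tau> (app (app (app (sem e (ke (\<sigma> \<rightarrow> \<tau>))) g) f) x) (app y z)"
    if x: "x \<in> D (bty \<sigma>)" and z: "z \<in> D \<sigma>" and xz: "rel \<alpha> \<sigma> x z" for x z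
  proof -
    have e: "env (g # e) ?\<Gamma>1" "env (f # g # e) ?\<Gamma>2" "env (x # f # g # e) ?\<Gamma>3"
      using Fun x by auto
    have k: "app f \<alpha> \<in> D N"
      using Fun.prems(3) assms(1) app_in by simp
    then have e4: "env (app f \<alpha> # x # f # g # e) (N # ?\<Gamma>3)"
      using e(3) by simp
    have L: "sem (x # f # g # e) ?L \<in> D (N \<rightarrow> bty \<tau>)"
      by (rule sem_in_infer[OF e(3)]) simp
    have "app (sem (x # f # g # e) ?L) (app f \<alpha>) = app (app g (app f \<alpha>)) x"
      using k by (simp add: app_sem_Lam[OF e(3)] sem_App_infer[OF e4] sem_Var_env[OF e4])
    then have "rel \<alpha> \<tau> (app (sem (x # f # g # e) ?L) (app f \<alpha>)) (app y z)"
      using Fun.prems(4) x z xz by simp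
    then have "rel \<alpha> \<tau> (app (app (sem (x # f # g # e) (ke \<tau>)) (sem (x # f # g # e) ?L)) f) (app y z)"
      by (rule Fun.IH(2)[OF e(3) L Fun.prems(3)])
    then show ?thesis
      using Fun.prems x
      by (simp add: app_sem_Lam[OF Fun.prems(1)] e[THEN app_sem_Lam] sem_App_infer[OF e(3)]
          sem_Var_env[OF e(3)])
  qed
  then show ?case by simp
qed

lemma rel_Succ:
  assumes "\<alpha> \<in> D (N \<rightarrow> N)" "env e' \<Gamma>'" "env e \<Gamma>"
  shows "rel \<alpha> (N \<rightarrow> N) (sem e' (btr Succ)) (sem e Succ)"
proof -
  have "app (app (sem e' (btr Succ)) x) \<alpha> = app (sem e Succ) (app x \<alpha>)"
    if x: "x \<in> D (bty N)" for x
  proof -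
    have e: "env (x # e') (bty N # \<Gamma>')" "env (\<alpha> # x # e') ((N \<rightarrow> N) # bty N # \<Gamma>')"
      using assms x by auto
    \<comment> \<open>\<open>Succ\<close> is evaluated in two different environments, and its values
      are prescribed only at numerals, where they agree.\<close>
    obtain n where n: "app x \<alpha> = num n"
      using app_in[of x "N \<rightarrow> N" N \<alpha>] x assms(1) D_N by auto
    show ?thesis
      using assms(1) x sem_Succ[OF e(2)] sem_Succ[OF assms(3)]
      by (simp add: n app_sem_Lam[OF assms(2)] app_sem_Lam[OF e(1)] sem_App_infer[OF e(2)]
          sem_Var_env[OF e(2)])
  qed
  then show ?thesis by simp
qed

text \<open>Induction on \<open>i\<close> relates the two recursors at each numeral
  \<open>num i\<close>; \<open>rel_ke\<close> then carries this over to a translated argument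
  \<open>n\<close>, whose value at \<open>\<alpha>\<close> is a numeral.\<close>

lemma rel_Rec:
  assumes "\<alpha> \<in> D (N \<rightarrow> N)" "env e' \<Gamma>'" "env e \<Gamma>"
  shows "rel \<alpha> (\<rho> \<rightarrow> (N \<rightarrow> \<rho> \<rightarrow> \<rho>) \<rightarrow> N \<rightarrow> \<rho>) (sem e' (btr (Rec \<rho>))) (sem e (Rec \<rho>))"
proof -
  have "rel \<alpha> \<rho> (app (app (app (sem e' (btr (Rec \<rho>))) a) f) n)
      (app (app (app (sem e (Rec \<rho>)) b) g) (app n \<alpha>))"
    if a: "a \<in> D (bty \<rho>)" and b: "b \<in> D \<rho>" and ab: "rel \<alpha> \<rho> a b"
      and f: "f \<in> D (bty (N \<rightarrow> \<rho> \<rightarrow> \<rho>))" and g: "g \<in> D (N \<rightarrow> \<rho> \<rightarrow> \<rho>)"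
      and fg: "rel \<alpha> (N \<rightarrow> \<rho> \<rightarrow> \<rho>) f g" and n: "n \<in> D (bty N)" for a b f g n
  proof -
    let ?\<Gamma>1 = "bty \<rho> # \<Gamma>'"
    let ?\<Gamma>2 = "bty (N \<rightarrow> \<rho> \<rightarrow> \<rho>) # ?\<Gamma>1"
    let ?e = "f # a # e'"
    \<comment> \<open>\<open>?K\<close> is the constant function with value \<open>k\<close>,
      \<open>?S\<close> is \<open>k \<mapsto> f ?K\<close>, and \<open>?R\<close> is the recursor at
      the translated type awaiting its numeral.\<close>
    let ?K = "Lam (N \<rightarrow> N) (Var 1)"
    let ?S = "Lam N (App (Var 1) ?K)"
    let ?R = "App (App (Rec (bty \<rho>)) (Var 1)) ?S"
    have e: "env (a # e') ?\<Gamma>1" "env ?e ?\<Gamma>2"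
      using assms a f by auto
    have S: "sem ?e ?S \<in> D (N \<rightarrow> bty \<rho> \<rightarrow> bty \<rho>)" and R: "sem ?e ?R \<in> D (N \<rightarrow> bty \<rho>)"
      by (rule sem_in_infer[OF e(2)], simp)+
    have R_eq: "sem ?e ?R = app (app (sem ?e (Rec (bty \<rho>))) a) (sem ?e ?S)"
      by (simp add: sem_App_infer[OF e(2)] sem_Var_env[OF e(2)])
    have num_in: "num i \<in> D N" for i
      using D_N by simp
    have rec: "rel \<alpha> \<rho> (app (sem ?e ?R) (num i)) (app (app (app (sem e (Rec \<rho>)) b) g) (num i))" for i
    proof (induction i)
      case 0
      show ?case
        using ab by (simp only: R_eq sem_Rec_0[OF e(2) a S] sem_Rec_0[OF assms(3) b g])
    next
      case (Suc i)
      let ?i = "num i # ?e"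
      have e3: "env ?i (N # ?\<Gamma>2)" and e4: "env (\<alpha> # ?i) ((N \<rightarrow> N) # N # ?\<Gamma>2)"
        using e(2) num_in assms(1) by auto
      have K: "sem ?i ?K \<in> D (bty N)"
        by (rule sem_in_infer[OF e3]) simp
      \<comment> \<open>This says that the constant function is related to \<open>num i\<close>, so
        \<open>fg\<close> applies to the pair.\<close>
      have "app (sem ?i ?K) \<alpha> = num i"
        using assms(1) by (simp add: app_sem_Lam[OF e3] sem_Var_env[OF e4])
      then have 1: "rel \<alpha> (\<rho> \<rightarrow> \<rho>) (app f (sem ?i ?K)) (app g (num i))"
        using fg K num_in rel.simps(1) rel.simps(2)[of \<alpha> N] by metis
      have 2: "app (sem ?e ?S) (num i) = app f (sem ?i ?K)"
        using num_in by (simp add: app_sem_Lam[OF e(2)] sem_App_infer[OF e3] sem_Var_env[OF e3])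
      have "app (sem ?e ?R) (num i) \<in> D (bty \<rho>)"
        using app_in[OF R num_in] .
      moreover have "app (app (app (sem e (Rec \<rho>)) b) g) (num i) \<in> D \<rho>"
        using sem_in_infer[OF assms(3), of "Rec \<rho>"] b g num_in app_in by (metis infer.simps(6))
      ultimately have "rel \<alpha> \<rho> (app (app f (sem ?i ?K)) (app (sem ?e ?R) (num i)))
          (app (app g (num i)) (app (app (app (sem e (Rec \<rho>)) b) g) (num i)))"
        using 1 Suc by simp
      then show ?case
        by (simp only: R_eq 2 sem_Rec_Suc[OF e(2) a S] sem_Rec_Suc[OF assms(3) b g])
    qed
    \<comment> \<open>Every object of type \<open>N\<close> is a numeral, so \<open>rec\<close>
      supplies the last premise of \<open>rel_ke\<close>.\<close>
    obtain i where "app n \<alpha> = num i"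
      using app_in[of n "N \<rightarrow> N" N \<alpha>] n assms(1) D_N by auto
    then have "rel \<alpha> \<rho> (app (app (sem ?e (ke \<rho>)) (sem ?e ?R)) n)
        (app (app (app (sem e (Rec \<rho>)) b) g) (app n \<alpha>))"
      using rel_ke[OF assms(1) e(2) R n] rec by simp
    moreover have "app (app (sem e' (btr (Rec \<rho>))) a) f = app (sem ?e (ke \<rho>)) (sem ?e ?R)"
    proof -
      have "app (app (sem e' (btr (Rec \<rho>))) a) f = sem ?e (App (ke \<rho>) ?R)"
        using a f by (simp add: app_sem_Lam[OF assms(2)] app_sem_Lam[OF e(1)])
      also have "\<dots> = app (sem ?e (ke \<rho>)) (sem ?e ?R)"
        by (rule sem_App_infer[OF e(2)]) simp
      finally show ?thesis .
    qed
    ultimately show ?thesis by simp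
  qed
  then show ?thesis by simp
qed

text \<open>The fundamental property of the logical relation, stated for open terms in pointwise
  related environments so that the induction passes under binders.\<close>

lemma rel_btr:
  assumes "\<alpha> \<in> D (N \<rightarrow> N)" "\<Gamma> \<turnstile> t : \<tau>" "env e' (map bty \<Gamma>)" "env e \<Gamma>"
    and "\<And>i. i < length \<Gamma> \<Longrightarrow> rel \<alpha> (\<Gamma> ! i) (e' ! i) (e ! i)"
  shows "rel \<alpha> \<tau> (sem e' (btr t)) (sem e t)"
  using assms(2-)
proof (induction arbitrary: e' e rule: has_type.induct)
  case (Var i \<Gamma>)
  then show ?case by (simp add: sem_Var_env[OF Var(2)] sem_Var_env[OF Var(3)])
next
  case (Lam \<sigma> \<Gamma> u \<tau>)
  have "rel \<alpha> \<tau> (sem (x # e') (btr u)) (sem (y # e) u)"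
    if "x \<in> D (bty \<sigma>)" "y \<in> D \<sigma>" "rel \<alpha> \<sigma> x y" for x y
    \<comment> \<open>Index 0 of the extended environments is the new related pair; higher indices
      are covered by the old hypothesis.\<close>
    using that Lam.prems by (intro Lam.IH) (auto simp: nth_Cons split: nat.split)
  moreover have "infer (bty \<sigma> # map bty \<Gamma>) (btr u) = Some (bty \<tau>)"
    using infer_complete[OF btr_type[OF Lam.hyps]] by simp
  ultimately show ?case
    by (simp add: app_sem_Lam[OF Lam.prems(1)]
        app_sem_Lam[OF Lam.prems(2) infer_complete[OF Lam.hyps]])
next
  case (App \<Gamma> s \<sigma> \<tau> t)
  note types = App.hyps[THEN infer_complete] App.hyps[THEN btr_type, THEN infer_complete]
  have "sem e' (btr t) \<in> D (bty \<sigma>)" "sem e t \<in> D \<sigma>"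
    using App.prems App.hyps(2) btr_type sem_in by blast+
  moreover have "rel \<alpha> (\<sigma> \<rightarrow> \<tau>) (sem e' (btr s)) (sem e s)" "rel \<alpha> \<sigma> (sem e' (btr t)) (sem e t)"
    using App by blast+
  ultimately show ?case
    using types by (simp add: sem_App_infer[OF App.prems(1)] sem_App_infer[OF App.prems(2)])
next
  case (Zero \<Gamma>)
  then have e: "env (\<alpha> # e') ((N \<rightarrow> N) # map bty \<Gamma>)"
    using assms(1) by simp
  show ?case
    using assms(1) by (simp add: app_sem_Lam[OF Zero(1)] sem_Zero[OF e] sem_Zero[OF Zero(2)])
next
  case (Succ \<Gamma>)
  then show ?case using rel_Succ[OF assms(1)] by blast
next
  case (Rec \<Gamma> \<rho>)
  then show ?case using rel_Rec[OF assms(1)] by blast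
qed

text \<open>Two beta steps give \<open>Omega x \<alpha> = \<alpha> (x \<alpha>)\<close>, which is
  what relatedness at \<open>N \<rightarrow> N\<close> demands once the partner of \<open>x\<close>
  is replaced by \<open>x \<alpha>\<close>.\<close>

lemma rel_Omega:
  assumes "\<alpha> \<in> D (N \<rightarrow> N)"
  shows "rel \<alpha> (N \<rightarrow> N) (sem [] Omega) \<alpha>"
proof -
  have "app (app (sem [] Omega) x) \<alpha> = app \<alpha> (app x \<alpha>)" if x: "x \<in> D (bty N)" for x
  proof -
    have e: "env [] []" "env [x] [bty N]" "env [\<alpha>, x] [N \<rightarrow> N, bty N]"
      using assms x by auto
    show ?thesis
      using assms x by (simp add: Omega_def app_sem_Lam[OF e(1)] app_sem_Lam[OF e(2)]
          sem_App_infer[OF e(3)] sem_Var_env[OF e(3)])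
  qed
  then show ?thesis by simp
qed

end

theorem theorem2p5:
  fixes D :: "ty \<Rightarrow> 'u set"
    and app :: "'u \<Rightarrow> 'u \<Rightarrow> 'u"
    and num :: "nat \<Rightarrow> 'u"
    and sem :: "'u list \<Rightarrow> tm \<Rightarrow> 'u"
    and f :: tm
  assumes "T_model D app num sem"
    and "[] \<turnstile> f : (N \<rightarrow> N) \<rightarrow> N"
  shows "\<forall>\<alpha> \<in> D (N \<rightarrow> N). app (sem [] (App (btr f) Omega)) \<alpha> = app (sem [] f) \<alpha>"
proof
  fix \<alpha> assume \<alpha>: "\<alpha> \<in> D (N \<rightarrow> N)"
  interpret T_model D app num sem by fact
  have bf: "[] \<turnstile> btr f : (bty N \<rightarrow> bty N) \<rightarrow> bty N"
    using btr_type[OF assms(2)] by simp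
  have "sem [] Omega \<in> D (bty (N \<rightarrow> N))"
    using sem_in[OF Omega_type, of "[]"] by simp
  \<comment> \<open>As \<open>f\<close> is closed, the conditions on environments are
    vacuous.\<close>
  moreover have "rel \<alpha> ((N \<rightarrow> N) \<rightarrow> N) (sem [] (btr f)) (sem [] f)"
    using rel_btr[OF \<alpha> assms(2)] by simp
  \<comment> \<open>Feeding the related pair \<open>Omega\<close> and \<open>\<alpha>\<close> to
    \<open>f\<close> lands at type \<open>N\<close>, where \<open>rel\<close> is the desired
    equation.\<close>
  ultimately have "rel \<alpha> N (app (sem [] (btr f)) (sem [] Omega)) (app (sem [] f) \<alpha>)"
    using rel_Omega[OF \<alpha>] \<alpha> rel.simps(2)[of \<alpha> "N \<rightarrow> N" N] by blast
  then show "app (sem [] (App (btr f) Omega)) \<alpha> = app (sem [] f) \<alpha>"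
    using sem_App[OF has_type.App[OF bf Omega_type], of "[]"] by simp
qed

end
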